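(* Let $x=(\nu_1,\dots,\nu_8;\kappa_1,\kappa_2;f,g)$ and let $x'=(\nu'_1,\dots,\nu'_8;\kappa'_1,\kappa'_2;f',g')\in K^{12}$ be a tuple with $x'\sim x$, where $\sim$ is the equivalence of type $E_7^{(1)}$ given in the context. Then for each generator $w\in\{s_0,s_1,s_2,s_3,s_4,s_5,s_6,s_7,\pi\}$ of $\widetilde W(E_7^{(1)})$, the action of $w$ on $x'$ has the same form as its action on $x$ up to the equivalence; that is, writing $w(x)=R_w(x)$ with $R_w$ the explicit tuple of rational expressions defining $w$, $$\bigl(w(\nu'_1),\dots,w(\nu'_8);w(\kappa'_1),w(\kappa'_2);w(f'),w(g')\bigr)\sim R_w(\nu'_1,\dots,\nu'_8;\kappa'_1,\kappa'_2;f',g').$$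
   Context: Let $K=\mathbb{C}(\nu_1,\dots,\nu_8,\kappa_1,\kappa_2,f,g)$ be the field of rational functions in 12 independent variables, and put $q=\kappa_1^2\kappa_2^2/(\nu_1\nu_2\cdots\nu_8)\in K$ (i.e. $\kappa_1^2\kappa_2^2=q\,\nu_1\cdots\nu_8$). Action of the generators of the extended affine Weyl group $\widetilde W(E_7^{(1)})$: the following are $\mathbb{C}$-algebra automorphisms of $K$; variables not mentioned are fixed. - $s_0:\ \kappa_1\leftrightarrow\kappa_2,\ f\to1/g,\ g\to1/f$. - $s_1:\nu_3\leftrightarrow\nu_4$; $s_2:\nu_2\leftrightarrow\nu_3$; $s_3:\nu_1\leftrightarrow\nu_2$; $s_5:\nu_5\leftrightarrow\nu_6$; $s_6:\nu_6\leftrightarrow\nu_7$; $s_7:\nu_7\leftrightarrow\nu_8$. - $s_4:\ \nu_1\to\frac{\kappa_2}{\nu_5},\ \nu_5\to\frac{\kappa_2}{\nu_1},\ \kappa_1\to\frac{\kappa_1\kappa_2}{\nu_1\nu_5},\ f\to\frac{-\kappa_2(\nu_1\nu_5-\kappa_1)fg-\nu_5(\kappa_1-\kappa_2)f+\kappa_1(\nu_1\nu_5-\kappa_2)}{\nu_5\{-(\nu_1\nu_5-\kappa_2)fg+\nu_1(\kappa_1-\kappa_2)g+(\nu_1\nu_5-\kappa_1)\}}$. - $\pi:\ \nu_1\to1/\nu_5,\ \nu_2\to1/\nu_6,\ \nu_3\to1/\nu_7,\ \nu_4\to1/\nu_8,\ \nu_5\to1/\nu_1,\ \nu_6\to1/\nu_2,\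 \nu_7\to1/\nu_3,\ \nu_8\to1/\nu_4,\ \kappa_1\to1/\kappa_1,\ \kappa_2\to1/\kappa_2,\ f\to f/\kappa_1,\ g\to\kappa_2 g$ (and $q\to1/q$). For each generator $w$, $R_w$ denotes the 12-tuple of rational expressions listed above giving $(w(\nu_1),\dots,w(\nu_8);w(\kappa_1),w(\kappa_2);w(f),w(g))$ in terms of $x$; $R_w(x')$ is obtained by substituting the entries of $x'$ for the corresponding variables. Equivalence of type $E_7^{(1)}$: two tuples $y'$ and $y=(\nu_1,\dots,\nu_8;\kappa_1,\kappa_2;f,g)$ with entries in $K$ satisfy $y'\sim y$ iff there exist $a,b\in K\setminus\{0\}$ such that $$y'=(a\nu_1,a\nu_2,a\nu_3,a\nu_4,b\nu_5,b\nu_6,b\nu_7,b\nu_8;\ ab\,\kappa_1,\ ab\,\kappa_2;\ af,\ g/a)$$ (here $\nu_i,\kappa_i,f,g$ denote the entries of $y$, whatever elements of $K$ they are). *)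

theory Defs
  imports Complex_Main "HOL-Library.Poly_Mapping" "HOL-Computational_Algebra.Fraction_Field"
begin

datatype var =
    Nu1 | Nu2 | Nu3 | Nu4 | Nu5 | Nu6 | Nu7 | Nu8 | Kappa1 | Kappa2 | F | G

text \<open>
  The linear order on the variables carries no mathematical content; it is what the library
  requires in order to know that polynomials over these variables form an integral domain.
\<close>

fun var_rank :: "var \<Rightarrow> nat" where
  "var_rank Nu1 = 1" | "var_rank Nu2 = 2" | "var_rank Nu3 = 3" | "var_rank Nu4 = 4"
| "var_rank Nu5 = 5" | "var_rank Nu6 = 6" | "var_rank Nu7 = 7" | "var_rank Nu8 = 8"
| "var_rank Kappa1 = 9" | "var_rank Kappa2 = 10" | "var_rank F = 11" | "var_rank G = 12"

lemma var_rank_inj: "var_rank u = var_rank v \<Longrightarrow> u = v"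
  by (cases u; cases v) simp_all

instantiation var :: linorder
begin
definition less_eq_var :: "var \<Rightarrow> var \<Rightarrow> bool" where "u \<le> v \<longleftrightarrow> var_rank u \<le> var_rank v"
definition less_var :: "var \<Rightarrow> var \<Rightarrow> bool" where "u < v \<longleftrightarrow> var_rank u < var_rank v"
instance
  by intro_classes (auto simp: less_eq_var_def less_var_def intro: var_rank_inj)
end

lemma UNIV_var:
  "(UNIV :: var set) = {Nu1, Nu2, Nu3, Nu4, Nu5, Nu6, Nu7, Nu8, Kappa1, Kappa2, F, G}"
  using var.exhaust by blast

instance var :: finite
  by intro_classes (simp add: UNIV_var)

text \<open>
  A monomial is an exponent vector \<^typ>\<open>var \<Rightarrow>\<^sub>0 nat\<close>, a polynomial is a finitely supported
  family of complex coefficients indexed by monomials, and \<open>K\<close> is the fraction field.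
\<close>

type_synonym mpoly = "(var \<Rightarrow>\<^sub>0 nat) \<Rightarrow>\<^sub>0 complex"
type_synonym K = "mpoly fract"

definition cst :: "complex \<Rightarrow> K" where
  "cst c = Fract (Poly_Mapping.single 0 c) 1"

text \<open>A 12-tuple over \<open>'a\<close> is a function \<^typ>\<open>var \<Rightarrow> 'a\<close>; \<open>X\<close> is the tuple of the independent variables.\<close>

definition X :: "var \<Rightarrow> K" where
  "X v = Fract (Poly_Mapping.single (Poly_Mapping.single v 1) 1) 1"

definition poly_eval :: "(var \<Rightarrow> K) \<Rightarrow> mpoly \<Rightarrow> K" where
  "poly_eval y p =
     (\<Sum>m\<in>Poly_Mapping.keys p.
        cst (Poly_Mapping.lookup p m) * (\<Prod>v\<in>UNIV. y v ^ Poly_Mapping.lookup m v))"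

text \<open>
  \<open>rat_eval y z\<close> substitutes the tuple \<open>y\<close> into the rational function \<open>z\<close>, using any
  representation of \<open>z\<close> whose denominator does not vanish at \<open>y\<close>.
\<close>

definition rat_eval :: "(var \<Rightarrow> K) \<Rightarrow> K \<Rightarrow> K" where
  "rat_eval y z =
     (THE u. \<exists>p r. z = Fract p r \<and> poly_eval y r \<noteq> 0 \<and> u = poly_eval y p / poly_eval y r)"

datatype generator = S0 | S1 | S2 | S3 | S4 | S5 | S6 | S7 | Pi

text \<open>
  \<open>R w x\<close> is the tuple of rational expressions defining \<open>w\<close>, with the entries of \<open>x\<close> in place
  of the variables. All right-hand sides refer to the old tuple \<open>x\<close>. At \<open>X\<close> and at every tuple
  equivalent to \<open>X\<close> (see below) all the denominators are nonzero, so the library's convention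
  for division by zero plays no role there. The element
  \<open>q = \<kappa>\<^sub>1\<^sup>2 \<kappa>\<^sub>2\<^sup>2 / (\<nu>\<^sub>1 \<cdots> \<nu>\<^sub>8)\<close> is not a separate variable; its images under the
  generators are determined by those of the variables.
\<close>

fun R :: "generator \<Rightarrow> (var \<Rightarrow> 'a::field) \<Rightarrow> (var \<Rightarrow> 'a)" where
  "R S0 x = x(Kappa1 := x Kappa2, Kappa2 := x Kappa1, F := 1 / x G, G := 1 / x F)"
| "R S1 x = x(Nu3 := x Nu4, Nu4 := x Nu3)"
| "R S2 x = x(Nu2 := x Nu3, Nu3 := x Nu2)"
| "R S3 x = x(Nu1 := x Nu2, Nu2 := x Nu1)"
| "R S4 x =
     x(Nu1 := x Kappa2 / x Nu5,
       Nu5 := x Kappa2 / x Nu1,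
       Kappa1 := x Kappa1 * x Kappa2 / (x Nu1 * x Nu5),
       F := (- x Kappa2 * (x Nu1 * x Nu5 - x Kappa1) * x F * x G
              - x Nu5 * (x Kappa1 - x Kappa2) * x F
              + x Kappa1 * (x Nu1 * x Nu5 - x Kappa2))
            / (x Nu5 * (- (x Nu1 * x Nu5 - x Kappa2) * x F * x G
                        + x Nu1 * (x Kappa1 - x Kappa2) * x G
                        + (x Nu1 * x Nu5 - x Kappa1))))"
| "R S5 x = x(Nu5 := x Nu6, Nu6 := x Nu5)"
| "R S6 x = x(Nu6 := x Nu7, Nu7 := x Nu6)"
| "R S7 x = x(Nu7 := x Nu8, Nu8 := x Nu7)"
| "R Pi x =
     x(Nu1 := 1 / x Nu5, Nu2 := 1 / x Nu6, Nu3 := 1 / x Nu7, Nu4 := 1 / x Nu8,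
       Nu5 := 1 / x Nu1, Nu6 := 1 / x Nu2, Nu7 := 1 / x Nu3, Nu8 := 1 / x Nu4,
       Kappa1 := 1 / x Kappa1, Kappa2 := 1 / x Kappa2,
       F := x F / x Kappa1, G := x Kappa2 * x G)"

text \<open>
  The action of a generator on \<open>K\<close>: the automorphism over the complex numbers that sends each
  variable \<open>X v\<close> to \<open>R w X v\<close>, that is, substitution of the tuple \<open>R w X\<close>.
\<close>

definition act :: "generator \<Rightarrow> K \<Rightarrow> K" where
  "act w = rat_eval (R w X)"

fun scale :: "'a::field \<Rightarrow> 'a \<Rightarrow> (var \<Rightarrow> 'a) \<Rightarrow> (var \<Rightarrow> 'a)" where
  "scale a b y Nu1 = a * y Nu1"
| "scale a b y Nu2 = a * y Nu2"
| "scale a b y Nu3 = a * y Nu3"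
| "scale a b y Nu4 = a * y Nu4"
| "scale a b y Nu5 = b * y Nu5"
| "scale a b y Nu6 = b * y Nu6"
| "scale a b y Nu7 = b * y Nu7"
| "scale a b y Nu8 = b * y Nu8"
| "scale a b y Kappa1 = a * b * y Kappa1"
| "scale a b y Kappa2 = a * b * y Kappa2"
| "scale a b y F = a * y F"
| "scale a b y G = y G / a"

definition equiv_E7 :: "(var \<Rightarrow> K) \<Rightarrow> (var \<Rightarrow> K) \<Rightarrow> bool" (infix "\<sim>" 50) where
  "y' \<sim> y \<longleftrightarrow> (\<exists>a b. a \<noteq> 0 \<and> b \<noteq> 0 \<and> y' = scale a b y)"

end

theory Submission
  imports Defs
begin

text \<open>
  Substitution of a tuple \<open>y\<close> is a partial ring homomorphism on \<open>K\<close>, defined on the fractions whose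
  denominator does not vanish at \<open>y\<close>. Each generator \<open>w\<close> is an involution, so substituting
  \<open>y = R w X\<close> into \<open>y v\<close> returns \<open>X v\<close>; hence substituting \<open>y\<close> into the value at \<open>y\<close> of a
  polynomial returns the polynomial. So no nonzero polynomial vanishes at \<open>y\<close>, and \<open>act w\<close>
  is an endomorphism of the field \<open>K\<close>. The theorem then follows from the homogeneity of the rational
  expressions \<open>R w\<close> under the rescaling.
\<close>

section \<open>Evaluation of polynomials\<close>

lemma cst_0 [simp]: "cst 0 = 0"
  by (simp add: cst_def Zero_fract_def)

lemma cst_1 [simp]: "cst 1 = 1"
  by (simp add: cst_def One_fract_def)

lemma cst_add: "cst (c + d) = cst c + cst d"
  by (simp add: cst_def single_add)

lemma cst_mult: "cst (c * d) = cst c * cst d"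
  by (simp add: cst_def mult_single)

lemma poly_mapping_sum_singles:
  "p = (\<Sum>m\<in>Poly_Mapping.keys p. Poly_Mapping.single m (Poly_Mapping.lookup p m))"
  by (rule poly_mapping_eqI) (auto simp: lookup_sum lookup_single when_def in_keys_iff)

lemma poly_mapping_single_plus_induct [case_names zero single plus]:
  fixes p :: "'a \<Rightarrow>\<^sub>0 'b::comm_monoid_add"
  assumes "P 0" "\<And>m c. P (Poly_Mapping.single m c)" "\<And>p r. P p \<Longrightarrow> P r \<Longrightarrow> P (p + r)"
  shows "P p"
proof -
  have "P (\<Sum>m\<in>M. Poly_Mapping.single m (Poly_Mapping.lookup p m))" if "finite M" for M
    using that by induction (auto intro: assms)
  from this[OF finite_keys] show ?thesis
    by (subst poly_mapping_sum_singles)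
qed

text \<open>Monomials outside the support contribute 0, so polynomials with different supports can
  be evaluated over one common index set.\<close>

lemma poly_eval_superset:
  assumes "finite M" "Poly_Mapping.keys p \<subseteq> M"
  shows "poly_eval y p =
    (\<Sum>m\<in>M. cst (Poly_Mapping.lookup p m) * (\<Prod>v\<in>UNIV. y v ^ Poly_Mapping.lookup m v))"
  unfolding poly_eval_def
  by (rule sum.mono_neutral_left) (use assms in \<open>auto simp: in_keys_iff\<close>)

lemma poly_eval_single:
  "poly_eval y (Poly_Mapping.single m c) = cst c * (\<Prod>v\<in>UNIV. y v ^ Poly_Mapping.lookup m v)"
  by (subst poly_eval_superset[of "{m}"]) (auto simp: lookup_single)

lemma poly_eval_0 [simp]: "poly_eval y 0 = 0"
  by (simp add: poly_eval_def)

lemma poly_eval_1 [simp]: "poly_eval y 1 = 1"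
  using poly_eval_single[of y 0 1] by simp

lemma poly_eval_var [simp]:
  "poly_eval y (Poly_Mapping.single (Poly_Mapping.single v 1) 1) = y v"
proof -
  have "y u ^ Poly_Mapping.lookup (Poly_Mapping.single v 1) u = (if u = v then y u else 1)" for u
    by (simp add: lookup_single when_def)
  then show ?thesis
    unfolding poly_eval_single by (simp add: prod.delta)
qed

lemma poly_eval_add: "poly_eval y (p + r) = poly_eval y p + poly_eval y r"
proof -
  let ?M = "Poly_Mapping.keys p \<union> Poly_Mapping.keys r"
  have "finite ?M" by simp
  moreover have "Poly_Mapping.keys (p + r) \<subseteq> ?M" by (rule keys_add)
  ultimately show ?thesis
    by (simp add: poly_eval_superset[of ?M] lookup_add cst_add distrib_right sum.distrib)
qed

lemma poly_eval_minus: "poly_eval y (- p) = - poly_eval y p"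
  using poly_eval_add[of y p "- p"] by (simp add: eq_neg_iff_add_eq_0 add.commute)

lemma poly_eval_mult: "poly_eval y (p * r) = poly_eval y p * poly_eval y r"
proof (induction p rule: poly_mapping_single_plus_induct)
  case (single m c)
  show ?case
  proof (induction r rule: poly_mapping_single_plus_induct)
    case (single m' c')
    show ?case
      by (simp add: mult_single poly_eval_single cst_mult lookup_add power_add prod.distrib)
  qed (simp_all add: poly_eval_add distrib_left)
qed (simp_all add: poly_eval_add distrib_right)

section \<open>Substitution into rational functions\<close>

text \<open>The relation under \<open>THE\<close> in \<open>rat_eval\<close>; it carries the
  definedness of a substitution along with its value.\<close>

definition rat_value :: "(var \<Rightarrow> K) \<Rightarrow> K \<Rightarrow> K \<Rightarrow> bool" where
  "rat_value y z u \<longleftrightarrow>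
     (\<exists>p r. z = Fract p r \<and> poly_eval y r \<noteq> 0 \<and> u = poly_eval y p / poly_eval y r)"

lemma rat_valueE:
  assumes "rat_value y z u"
  obtains p r where "z = Fract p r" "r \<noteq> 0" "poly_eval y r \<noteq> 0"
    "u = poly_eval y p / poly_eval y r"
  using assms unfolding rat_value_def by (metis poly_eval_0)

text \<open>Two representations of \<open>z\<close> satisfy \<open>p * r' = p' * r\<close>, and
  evaluation preserves this identity.\<close>

lemma rat_value_unique:
  assumes "rat_value y z u" "rat_value y z u'"
  shows "u = u'"
proof -
  obtain p r where 1: "z = Fract p r" "r \<noteq> 0" "poly_eval y r \<noteq> 0"
      "u = poly_eval y p / poly_eval y r"
    using assms(1) by (rule rat_valueE)
  obtain p' r' where 2: "z = Fract p' r'" "r' \<noteq> 0" "poly_eval y r' \<noteq> 0"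
      "u' = poly_eval y p' / poly_eval y r'"
    using assms(2) by (rule rat_valueE)
  from 1 2 have "p * r' = p' * r"
    by (simp add: eq_fract)
  then have "poly_eval y p * poly_eval y r' = poly_eval y p' * poly_eval y r"
    by (metis poly_eval_mult)
  then show ?thesis
    using 1 2 by (simp add: frac_eq_eq)
qed

lemma rat_eval_eq: "rat_value y z u \<Longrightarrow> rat_eval y z = u"
  unfolding rat_eval_def rat_value_def[symmetric] by (blast intro: rat_value_unique)

lemma rat_value_Fract_1: "rat_value y (Fract p 1) (poly_eval y p)"
  unfolding rat_value_def by (rule exI[of _ p], rule exI[of _ 1]) simp

lemma rat_value_X: "rat_value y (X v) (y v)"
  using rat_value_Fract_1[of y "Poly_Mapping.single (Poly_Mapping.single v 1) 1"]
  by (simp only: X_def poly_eval_var)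

lemma rat_value_cst: "rat_value y (cst c) (cst c)"
  using rat_value_Fract_1[of y "Poly_Mapping.single 0 c"]
  by (simp add: cst_def poly_eval_single)

lemma rat_value_1: "rat_value y 1 1"
  using rat_value_cst[of y 1] by simp

lemma rat_value_0: "rat_value y 0 0"
  using rat_value_cst[of y 0] by simp

lemma rat_value_add:
  assumes "rat_value y z u" "rat_value y z' u'"
  shows "rat_value y (z + z') (u + u')"
proof -
  obtain p r where 1: "z = Fract p r" "r \<noteq> 0" "poly_eval y r \<noteq> 0"
      "u = poly_eval y p / poly_eval y r"
    using assms(1) by (rule rat_valueE)
  obtain p' r' where 2: "z' = Fract p' r'" "r' \<noteq> 0" "poly_eval y r' \<noteq> 0"
      "u' = poly_eval y p' / poly_eval y r'"
    using assms(2) by (rule rat_valueE)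
  show ?thesis
    unfolding rat_value_def
    by (rule exI[of _ "p * r' + p' * r"], rule exI[of _ "r * r'"])
      (use 1 2 in \<open>simp add: poly_eval_add poly_eval_mult add_frac_eq\<close>)
qed

lemma rat_value_minus:
  assumes "rat_value y z u"
  shows "rat_value y (- z) (- u)"
proof -
  obtain p r where 1: "z = Fract p r" "r \<noteq> 0" "poly_eval y r \<noteq> 0"
      "u = poly_eval y p / poly_eval y r"
    using assms(1) by (rule rat_valueE)
  show ?thesis
    unfolding rat_value_def
    by (rule exI[of _ "- p"], rule exI[of _ r]) (use 1 in \<open>simp add: poly_eval_minus\<close>)
qed

lemma rat_value_diff:
  "rat_value y z u \<Longrightarrow> rat_value y z' u' \<Longrightarrow> rat_value y (z - z') (u - u')"
  using rat_value_add[OF _ rat_value_minus] by fastforce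

lemma rat_value_mult:
  assumes "rat_value y z u" "rat_value y z' u'"
  shows "rat_value y (z * z') (u * u')"
proof -
  obtain p r where 1: "z = Fract p r" "r \<noteq> 0" "poly_eval y r \<noteq> 0"
      "u = poly_eval y p / poly_eval y r"
    using assms(1) by (rule rat_valueE)
  obtain p' r' where 2: "z' = Fract p' r'" "r' \<noteq> 0" "poly_eval y r' \<noteq> 0"
      "u' = poly_eval y p' / poly_eval y r'"
    using assms(2) by (rule rat_valueE)
  show ?thesis
    unfolding rat_value_def
    by (rule exI[of _ "p * p'"], rule exI[of _ "r * r'"])
      (use 1 2 in \<open>simp add: poly_eval_mult\<close>)
qed

lemma rat_value_inverse:
  assumes "rat_value y z u" "u \<noteq> 0"
  shows "rat_value y (inverse z) (inverse u)"
proof -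
  obtain p r where 1: "z = Fract p r" "r \<noteq> 0" "poly_eval y r \<noteq> 0"
      "u = poly_eval y p / poly_eval y r"
    using assms(1) by (rule rat_valueE)
  show ?thesis
    unfolding rat_value_def
    \<comment> \<open>Numerator and denominator may be swapped, as \<open>u \<noteq> 0\<close>
      forces \<open>poly_eval y p \<noteq> 0\<close>.\<close>
    by (rule exI[of _ r], rule exI[of _ p]) (use 1 assms(2) in auto)
qed

lemma rat_value_divide:
  assumes "rat_value y z u" "rat_value y z' u'" "u' \<noteq> 0"
  shows "rat_value y (z / z') (u / u')"
  using rat_value_mult[OF assms(1) rat_value_inverse[OF assms(2,3)]]
  by (simp only: divide_inverse)

lemma rat_value_power: "rat_value y z u \<Longrightarrow> rat_value y (z ^ n) (u ^ n)"
  by (induction n) (auto intro: rat_value_1 rat_value_mult)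

lemma rat_value_sum:
  "(\<And>i. i \<in> I \<Longrightarrow> rat_value y (s i) (t i)) \<Longrightarrow> rat_value y (sum s I) (sum t I)"
  by (induction I rule: infinite_finite_induct) (auto intro: rat_value_0 rat_value_add)

lemma rat_value_prod:
  "(\<And>i. i \<in> I \<Longrightarrow> rat_value y (s i) (t i)) \<Longrightarrow> rat_value y (prod s I) (prod t I)"
  by (induction I rule: infinite_finite_induct) (auto intro: rat_value_1 rat_value_mult)

lemmas rat_value_intros =
  rat_value_X rat_value_cst rat_value_0 rat_value_1 rat_value_add rat_value_minus rat_value_diff
  rat_value_mult rat_value_divide rat_value_power rat_value_sum rat_value_prod

text \<open>Composition of substitutions: \<open>poly_eval x p\<close> is built from the entries of
  \<open>x\<close> by sums and products, which \<open>rat_value\<close> respects.\<close>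

lemma rat_value_poly_eval:
  assumes "\<And>v. rat_value y (x v) (t v)"
  shows "rat_value y (poly_eval x p) (poly_eval t p)"
  unfolding poly_eval_def by (intro rat_value_intros assms)

text \<open>The only value of 0 is 0. Hence specialising the variables suggestively suffices to show
  that an element of \<open>K\<close> is nonzero.\<close>

lemma rat_value_nonzero: "rat_value y z u \<Longrightarrow> u \<noteq> 0 \<Longrightarrow> z \<noteq> 0"
  using rat_value_unique rat_value_0 by blast

lemma poly_eval_X: "poly_eval X p = Fract p 1"
proof (induction p rule: poly_mapping_single_plus_induct)
  case (single m c)
  have pow: "X v ^ n = Fract (Poly_Mapping.single (Poly_Mapping.single v n) 1) 1" for v n
    by (induction n)
      (simp_all add: X_def One_fract_def mult_single single_add[symmetric])
  have "(\<Prod>v\<in>V. X v ^ Poly_Mapping.lookup m v) =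
      Fract (Poly_Mapping.single
        (\<Sum>v\<in>V. Poly_Mapping.single v (Poly_Mapping.lookup m v)) 1) 1" for V
    by (induction V rule: infinite_finite_induct) (simp_all add: pow One_fract_def mult_single)
  moreover have "(\<Sum>v\<in>UNIV. Poly_Mapping.single v (Poly_Mapping.lookup m v)) = m"
    by (rule poly_mapping_eqI) (simp add: lookup_sum lookup_single when_def)
  ultimately show ?case
    by (simp add: poly_eval_single cst_def mult_single)
qed (simp_all add: Zero_fract_def poly_eval_add)

text \<open>By assumption, substituting \<open>y\<close> twice fixes the variables, hence all
  polynomials. A denominator vanishing at \<open>y\<close> would therefore be 0.\<close>

lemma rat_value_total:
  assumes "\<And>v. rat_value y (y v) (X v)"
  obtains u where "rat_value y z u"
proof (cases z)
  case (Fract p r)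
  have "rat_value y (poly_eval y r) (Fract r 1)"
    using rat_value_poly_eval[where x = y and t = X and p = r, OF assms] by (simp only: poly_eval_X)
  moreover have "Fract r 1 \<noteq> 0"
    using Fract(2) by (simp add: Zero_fract_def eq_fract)
  ultimately have "poly_eval y r \<noteq> 0"
    by (rule rat_value_nonzero)
  with Fract(1) show ?thesis
    by (intro that) (auto simp: rat_value_def)
qed

section \<open>The generators are involutions\<close>

definition s4_denominator :: "(var \<Rightarrow> 'a::field) \<Rightarrow> 'a" where
  "s4_denominator x = - (x Nu1 * x Nu5 - x Kappa2) * x F * x G
     + x Nu1 * (x Kappa1 - x Kappa2) * x G + (x Nu1 * x Nu5 - x Kappa1)"

lemma X_nonzero: "X v \<noteq> 0"
  using rat_value_nonzero[OF rat_value_X[of "\<lambda>_. 1"]] by simp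

lemma s4_denominator_X_nonzero: "s4_denominator X \<noteq> 0"
proof -
  have "rat_value y (s4_denominator X) (s4_denominator y)" for y
    unfolding s4_denominator_def by (intro rat_value_intros)
  \<comment> \<open>At this tuple only the summand \<open>Nu1 * Nu5\<close> survives, and the value
    is 1.\<close>
  from rat_value_nonzero[OF this[of "(\<lambda>_. 0)(Nu1 := 1, Nu5 := 1)"]]
  show ?thesis by (simp add: s4_denominator_def)
qed

text \<open>The four factors of the determinant that has to be nonzero for \<open>S4\<close> to be
  invertible on \<open>F\<close>.\<close>

lemma X_relations:
  shows "X Kappa1 - X Kappa2 \<noteq> 0" "X Nu1 * X Nu5 - X Kappa1 \<noteq> 0"
    "X Kappa2 * X G - X Nu5 \<noteq> 0" "X Nu1 * X G - 1 \<noteq> 0"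
proof -
  have "rat_value y (X Kappa1 - X Kappa2) (y Kappa1 - y Kappa2)" for y
    by (intro rat_value_intros)
  from rat_value_nonzero[OF this[of "(\<lambda>_. 0)(Kappa1 := 1)"]]
  show "X Kappa1 - X Kappa2 \<noteq> 0" by simp
  have "rat_value y (X Nu1 * X Nu5 - X Kappa1) (y Nu1 * y Nu5 - y Kappa1)" for y
    by (intro rat_value_intros)
  from rat_value_nonzero[OF this[of "(\<lambda>_. 0)(Kappa1 := 1)"]]
  show "X Nu1 * X Nu5 - X Kappa1 \<noteq> 0" by simp
  have "rat_value y (X Kappa2 * X G - X Nu5) (y Kappa2 * y G - y Nu5)" for y
    by (intro rat_value_intros)
  from rat_value_nonzero[OF this[of "(\<lambda>_. 0)(Nu5 := 1)"]]
  show "X Kappa2 * X G - X Nu5 \<noteq> 0" by simp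
  have "rat_value y (X Nu1 * X G - 1) (y Nu1 * y G - 1)" for y
    by (intro rat_value_intros)
  from rat_value_nonzero[OF this[of "\<lambda>_. 0"]]
  show "X Nu1 * X G - 1 \<noteq> 0" by simp
qed

text \<open>The entry \<open>F\<close> by itself is a divisor only in \<open>S0\<close>. Exempting
  it elsewhere avoids a nonvanishing proof for the numerator of \<open>R S4 X F\<close>.\<close>

lemma rat_value_R:
  assumes "\<And>v. v \<noteq> F \<Longrightarrow> y v \<noteq> 0" and "w = S0 \<Longrightarrow> y F \<noteq> 0"
    and "w = S4 \<Longrightarrow> s4_denominator y \<noteq> 0"
  shows "rat_value y (R w X v) (R w y v)"
proof (cases w)
  case S4
  have "y Nu5 * s4_denominator y \<noteq> 0" using assms S4 by simp
  then show ?thesis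
    using S4 assms(1) by (auto simp: s4_denominator_def intro!: rat_value_intros)
qed (use assms in \<open>auto intro!: rat_value_intros\<close>)

text \<open>
  For fixed \<open>g\<close>, the map \<open>f \<mapsto> f'\<close> is a Moebius transformation; up to sign and a factor \<open>e\<close>, the product
  in assumption \<open>D\<close> is its determinant.
\<close>

lemma s4_F_involution:
  fixes a e k l f g :: "'a::field"
  assumes nz: "a \<noteq> 0" "e \<noteq> 0" "l \<noteq> 0"
    and M: "M = - (a * e - l) * f * g + a * (k - l) * g + (a * e - k)" "M \<noteq> 0"
    and N: "N = - l * (a * e - k) * f * g - e * (k - l) * f + k * (a * e - l)"
    and D: "(k - l) * (a * e - k) * (l * g - e) * (a * g - 1) \<noteq> 0"
    and a': "a' = l / e" and e': "e' = l / a" and k': "k' = k * l / (a * e)"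
    and f': "f' = N / (e * M)"
    and M': "M' = - (a' * e' - l) * f' * g + a' * (k' - l) * g + (a' * e' - k')"
    and N': "N' = - l * (a' * e' - k') * f' * g - e' * (k' - l) * f' + k' * (a' * e' - l)"
  shows "M' \<noteq> 0" "N' / (e' * M') = f"
proof -
  let ?D = "(k - l) * (a * e - k) * (l * g - e) * (a * g - 1)"
  \<comment> \<open>Clearing denominators makes \<open>M'\<close> a linear combination of
    \<open>N\<close> and \<open>M\<close> in which the terms with \<open>f\<close> cancel, leaving
    the determinant.\<close>
  have "M' * (a * e) * (e * M) = l * (- (l - a * e) * N * g + (l * (k - a * e) * g + e * (l - k)) * M)"
    using nz M(2) unfolding M' a' e' k' f' by (simp add: field_simps)
  also have "\<dots> = - l * ?D"
    unfolding M(1) N by algebra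
  finally have 1: "M' * (a * e) * (e * M) = - l * ?D" .
  with D nz M(2) show "M' \<noteq> 0" by auto
  \<comment> \<open>The square is needed because \<open>k' * (a' * e' - l)\<close> has denominator
    \<open>(a * e)^2\<close>. The result is \<open>f\<close> times the same determinant, which then
    cancels against \<open>M'\<close>.\<close>
  have "N' * (a * e)^2 * (e * M) =
      e * l^2 * ((k - l) * a * g * N - (k - a * e) * N + k * (l - a * e) * M)"
    using nz M(2) unfolding N' a' e' k' f' by (simp add: divide_simps) algebra
  also have "\<dots> = - e * l^2 * f * ?D"
    unfolding M(1) N by algebra
  also have "\<dots> = e * l * f * (M' * (a * e) * (e * M))"
    unfolding 1 by algebra
  also have "\<dots> = e' * M' * f * (a * e)^2 * (e * M)"
    using nz unfolding e' by (simp add: field_simps power2_eq_square)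
  finally have "N' = e' * M' * f"
    using nz M(2) by simp
  then show "N' / (e' * M') = f"
    using \<open>M' \<noteq> 0\<close> nz unfolding e' by simp
qed

lemma R_S4_involution_X: "s4_denominator (R S4 X) \<noteq> 0" "R S4 (R S4 X) = X"
proof -
  note inv = s4_F_involution[of "X Nu1" "X Nu5" "X Kappa2" _ "X F" "X G" "X Kappa1",
      OF X_nonzero X_nonzero X_nonzero refl _ refl _ refl refl refl refl refl refl]
  have nz: "s4_denominator X \<noteq> 0"
    "(X Kappa1 - X Kappa2) * (X Nu1 * X Nu5 - X Kappa1)
       * (X Kappa2 * X G - X Nu5) * (X Nu1 * X G - 1) \<noteq> 0"
    using s4_denominator_X_nonzero X_relations by simp_all
  show "s4_denominator (R S4 X) \<noteq> 0"
    using inv(1)[OF nz[unfolded s4_denominator_def]] by (simp add: s4_denominator_def)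
  have "R S4 (R S4 X) F = X F"
    using inv(2)[OF nz[unfolded s4_denominator_def]] by simp
  then show "R S4 (R S4 X) = X"
  proof (intro ext)
    show "R S4 (R S4 X) v = X v" for v
    proof (cases "v = F")
      case False
      then show ?thesis by (cases v) (simp_all add: X_nonzero)
    qed (use \<open>R S4 (R S4 X) F = X F\<close> in simp)
  qed
qed

lemma R_involution_X: "R w (R w X) = X"
proof (cases w)
  case S4
  then show ?thesis using R_S4_involution_X by simp
qed (auto simp: fun_eq_iff X_nonzero)

lemma R_X_nonzero: "v \<noteq> F \<or> w \<noteq> S4 \<Longrightarrow> R w X v \<noteq> 0"
  by (cases w) (auto simp: X_nonzero)

section \<open>The action on the field\<close>

text \<open>Since \<open>R w (R w X) = X\<close>, the tuple \<open>R w X\<close> meets the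
  assumption of \<open>rat_value_total\<close>, so \<open>act w\<close> is defined on all of
  \<open>K\<close>.\<close>

lemma rat_value_act: "rat_value (R w X) z (act w z)"
proof -
  have "rat_value (R w X) (R w X v) (R w (R w X) v)" for v
    by (rule rat_value_R) (auto simp: R_X_nonzero R_S4_involution_X simp del: R.simps)
  then obtain u where "rat_value (R w X) z u"
    by (metis R_involution_X rat_value_total)
  then show ?thesis
    by (simp add: act_def rat_eval_eq del: R.simps)
qed

lemma act_eqI: "rat_value (R w X) z u \<Longrightarrow> act w z = u"
  by (simp add: act_def rat_eval_eq del: R.simps)

lemma act_X: "act w (X v) = R w X v"
  by (intro act_eqI rat_value_X)

lemma act_mult: "act w (a * b) = act w a * act w b"
  by (intro act_eqI rat_value_mult rat_value_act)

lemma act_nonzero: "a \<noteq> 0 \<Longrightarrow> act w a \<noteq> 0"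
  using act_mult[of w a "1 / a"] act_eqI[OF rat_value_1, of w] by auto

lemma act_divide: "b \<noteq> 0 \<Longrightarrow> act w (a / b) = act w a / act w b"
  by (intro act_eqI rat_value_divide rat_value_act act_nonzero)

lemma act_scale:
  assumes "a \<noteq> 0"
  shows "act w (scale a b X v) = scale (act w a) (act w b) (R w X) v"
  by (cases v) (simp_all add: act_mult act_divide act_X assms del: R.simps)

section \<open>Homogeneity\<close>

text \<open>The numerator has weight \<open>a^2 * b^2\<close> and the denominator
  \<open>b * (a * b)\<close>, which leaves the weight \<open>a\<close> of \<open>F\<close>.\<close>

lemma s4_F_homogeneous:
  fixes a b :: "'a::field"
  assumes "a \<noteq> 0" "b \<noteq> 0"
  shows "R S4 (scale a b x) F = a * R S4 x F"
proof -
  define s4_numerator where "s4_numerator y = - y Kappa2 * (y Nu1 * y Nu5 - y Kappa1) * y F * y G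
    - y Nu5 * (y Kappa1 - y Kappa2) * y F + y Kappa1 * (y Nu1 * y Nu5 - y Kappa2)"
    for y :: "var \<Rightarrow> 'a"
  have R_F: "R S4 y F = s4_numerator y / (y Nu5 * s4_denominator y)" for y :: "var \<Rightarrow> 'a"
    by (simp add: s4_numerator_def s4_denominator_def)
  have "s4_numerator (scale a b x) = a^2 * b^2 * s4_numerator x"
    using assms by (simp add: s4_numerator_def field_simps power2_eq_square)
  moreover have "s4_denominator (scale a b x) = a * b * s4_denominator x"
    using assms by (simp add: s4_denominator_def field_simps)
  ultimately show ?thesis
    unfolding R_F using assms by (simp add: power2_eq_square)
qed

text \<open>\<open>Pi\<close> inverts the \<open>Nu\<close> entries and exchanges their two blocks,
  so its factors become \<open>1 / b\<close> and \<open>1 / a\<close>; the other generators preserve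
  weights.\<close>

lemma R_scale:
  fixes a b :: "'a::field"
  assumes "a \<noteq> 0" "b \<noteq> 0"
  shows "R w (scale a b x) =
    (if w = Pi then scale (1 / b) (1 / a) (R w x) else scale a b (R w x))"
proof (rule ext)
  fix v
  show "R w (scale a b x) v =
    (if w = Pi then scale (1 / b) (1 / a) (R w x) else scale a b (R w x)) v"
  proof (cases "w = S4 \<and> v = F")
    case True
    then show ?thesis using s4_F_homogeneous[OF assms, of x] by (simp del: R.simps)
  next
    case False
    then show ?thesis
      using assms by (cases w; cases v) (simp_all add: field_simps)
  qed
qed

lemma scale_scale: "scale a b (scale c d x) = scale (a * c) (b * d) x"
proof
  show "scale a b (scale c d x) v = scale (a * c) (b * d) x v" for v
    by (cases v) (simp_all add: mult_ac)
qed

lemma scale_equiv_scale: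
  assumes "a \<noteq> 0" "b \<noteq> 0" "c \<noteq> 0" "d \<noteq> 0"
  shows "scale a b y \<sim> scale c d y"
  unfolding equiv_E7_def scale_scale
  by (rule exI[of _ "a / c"], rule exI[of _ "b / d"]) (use assms in simp)

theorem theorem3p3:
  fixes x' :: "var \<Rightarrow> K" and w :: generator
  assumes "x' \<sim> X"
  shows "(\<lambda>v. act w (x' v)) \<sim> R w x'"
proof -
  obtain a b where ab: "a \<noteq> 0" "b \<noteq> 0" and x': "x' = scale a b X"
    using assms unfolding equiv_E7_def by blast
  show ?thesis
    \<comment> \<open>Both sides are now rescalings of \<open>R w X\<close>. Their factors may
      differ, since \<open>act w\<close> also moves \<open>a\<close> and \<open>b\<close>, but all
      of them are nonzero.\<close>
    unfolding x' act_scale[OF ab(1)] R_scale[OF ab]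
    using ab act_nonzero scale_equiv_scale by simp
qed

end
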